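(* Let $w:\mathbb{R}^{N+1}\to\mathbb{R}$ be the polynomial $w(x,t)=t-|x|^2$, $x\in\mathbb{R}^N$, $t\in\mathbb{R}$, and let $H=\Delta-\partial_t$ be the heat operator. Let $p$ be a polynomial in $\mathbb{R}^{N+1}$. Then there exists a unique polynomial $q$ in $\mathbb{R}^{N+1}$ such that $$H(wq)=-Hp .$$
   Context: $N\ge 1$ is an integer; points of $\mathbb{R}^{N+1}$ are written $z=(x,t)$ with $x\in\mathbb{R}^N$, $t\in\mathbb{R}$, and $|x|$ is the Euclidean norm of $x$. $\Delta=\sum_{j=1}^N\partial_{x_j}^2$ is the Laplacian in the spatial variables $x$. A polynomial in $\mathbb{R}^{N+1}$ is a polynomial function of $z=(x,t)$ with real coefficients. *)

theory Defs
  imports "HOL-Analysis.Analysis"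
begin

(* Points z = (x,t) of R^(N+1) are elements of (real ^ 'n) * real with N = CARD('n).
   Polynomials are the functions satisfying real_polynomial_function, i.e. the
   algebra generated by the constants and the (bounded) linear functionals; in
   finite dimension these functionals are the linear combinations of the coordinates,
   so this is the algebra of polynomial functions in x_1, ..., x_N, t. *)

definition partial_x :: "'n \<Rightarrow> ((real ^ 'n) \<times> real \<Rightarrow> real) \<Rightarrow> (real ^ 'n::finite) \<times> real \<Rightarrow> real" where
  "partial_x j f = (\<lambda>(x, t). deriv (\<lambda>s. f (x + s *\<^sub>R axis j 1, t)) 0)"

definition partial_t :: "((real ^ 'n) \<times> real \<Rightarrow> real) \<Rightarrow> (real ^ 'n::finite) \<times> real \<Rightarrow> real" where
  "partial_t f = (\<lambda>(x, t). deriv (\<lambda>s. f (x, s)) t)"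

definition laplacian_x :: "((real ^ 'n) \<times> real \<Rightarrow> real) \<Rightarrow> (real ^ 'n::finite) \<times> real \<Rightarrow> real" where
  "laplacian_x f = (\<lambda>z. \<Sum>j\<in>UNIV. partial_x j (partial_x j f) z)"

definition heat_op :: "((real ^ 'n) \<times> real \<Rightarrow> real) \<Rightarrow> (real ^ 'n::finite) \<times> real \<Rightarrow> real" where
  "heat_op f = (\<lambda>z. laplacian_x f z - partial_t f z)"

definition w_poly :: "(real ^ 'n::finite) \<times> real \<Rightarrow> real" where
  "w_poly = (\<lambda>(x, t). t - (norm x)\<^sup>2)"

end

theory Submission imports Defs "HOL-Library.Function_Algebras" begin

text \<open>
  Put \<open>T q = H (w q)\<close>. Give \<open>x\<^sub>j\<close> degree 1 and \<open>t\<close> degree 2: multiplication by \<open>w\<close> raises this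
  parabolic degree by at most 2 and \<open>H\<close> lowers it by 2, so \<open>T\<close> maps the finite-dimensional space of
  polynomials of parabolic degree at most \<open>m\<close> into itself. If \<open>T q = 0\<close>, then \<open>w q\<close> is caloric and
  vanishes on the paraboloid \<open>t = |x|\<^sup>2\<close>, which contains the parabolic boundary of each region
  \<open>|x|\<^sup>2 < t < c\<close>. By the maximum principle \<open>w q\<close>, and hence \<open>q\<close>, vanishes on the open set
  \<open>|x|\<^sup>2 < t\<close>, so \<open>q = 0\<close>. Thus \<open>T\<close> is injective, and bijective on each of these spaces.
\<close>

\<comment> \<open>HOL-Analysis hides the names of the individual introduction rules.\<close>
lemmas real_polynomial_function_linear = real_polynomial_function.intros(1)
  and real_polynomial_function_const = real_polynomial_function.intros(2)
  and real_polynomial_function_add = real_polynomial_function.intros(3)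
  and real_polynomial_function_mult = real_polynomial_function.intros(4)

section \<open>Directional derivatives of polynomial functions\<close>

text \<open>Both kinds of partial derivative are derivatives along lines in space-time, so one
  notion lets the sum and product rules be proved once for \<open>x\<close> and \<open>t\<close>
  alike.\<close>

definition dir_deriv :: "'a::real_normed_vector \<Rightarrow> ('a \<Rightarrow> real) \<Rightarrow> 'a \<Rightarrow> real" where
  "dir_deriv v f = (\<lambda>z. deriv (\<lambda>s. f (z + s *\<^sub>R v)) 0)"

text \<open>The induction needs an explicit polynomial witness \<open>g\<close>, valid at every
  point of every line, because \<open>deriv\<close> says nothing until differentiability is known.
  Afterwards \<open>g\<close> is identified with \<open>dir_deriv v f\<close>.\<close>

lemma real_polynomial_function_line_derivative:
  assumes "real_polynomial_function f"
  shows "\<exists>g. real_polynomial_function g \<and>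
           (\<forall>z s. ((\<lambda>s. f (z + s *\<^sub>R v)) has_real_derivative g (z + s *\<^sub>R v)) (at s))"
  using assms
proof induction
  case (linear f)
  interpret bounded_linear f by fact
  have "((\<lambda>s. f (z + s *\<^sub>R v)) has_real_derivative f v) (at s)" for z s
    unfolding add scaleR by (auto intro!: derivative_eq_intros)
  then show ?case by (intro exI[of _ "\<lambda>_. f v"]) auto
next
  case (const c)
  show ?case by (intro exI[of _ "\<lambda>_. 0"]) auto
next
  case (add f g)
  then obtain f' g' where "real_polynomial_function f'" "real_polynomial_function g'"
    "\<And>z s. ((\<lambda>s. f (z + s *\<^sub>R v)) has_real_derivative f' (z + s *\<^sub>R v)) (at s)"
    "\<And>z s. ((\<lambda>s. g (z + s *\<^sub>R v)) has_real_derivative g' (z + s *\<^sub>R v)) (at s)"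
    by blast
  then show ?case
    by (intro exI[of _ "\<lambda>z. f' z + g' z"]) (auto intro!: DERIV_add)
next
  case (mult f g)
  then obtain f' g' where "real_polynomial_function f'" "real_polynomial_function g'"
    "\<And>z s. ((\<lambda>s. f (z + s *\<^sub>R v)) has_real_derivative f' (z + s *\<^sub>R v)) (at s)"
    "\<And>z s. ((\<lambda>s. g (z + s *\<^sub>R v)) has_real_derivative g' (z + s *\<^sub>R v)) (at s)"
    by blast
  with mult show ?case
    by (intro exI[of _ "\<lambda>z. f' z * g z + g' z * f z"]) (auto intro!: DERIV_mult)
qed

lemma dir_deriv_eqI:
  assumes "\<And>z. ((\<lambda>s. f (z + s *\<^sub>R v)) has_real_derivative g z) (at 0)"
  shows "dir_deriv v f = g"
  unfolding dir_deriv_def using assms by (auto intro!: DERIV_imp_deriv)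

lemma
  assumes "real_polynomial_function f"
  shows real_polynomial_function_dir_deriv: "real_polynomial_function (dir_deriv v f)"
    and has_derivative_dir_deriv:
      "((\<lambda>s. f (z + s *\<^sub>R v)) has_real_derivative dir_deriv v f (z + s *\<^sub>R v)) (at s)"
proof -
  obtain g where g: "real_polynomial_function g"
    "\<And>z s. ((\<lambda>s. f (z + s *\<^sub>R v)) has_real_derivative g (z + s *\<^sub>R v)) (at s)"
    using real_polynomial_function_line_derivative[OF assms] by blast
  have "dir_deriv v f = g"
  proof (rule dir_deriv_eqI)
    show "((\<lambda>s. f (z + s *\<^sub>R v)) has_real_derivative g z) (at 0)" for z
      using g(2)[of z 0] by simp
  qed
  with g show "real_polynomial_function (dir_deriv v f)"
    "((\<lambda>s. f (z + s *\<^sub>R v)) has_real_derivative dir_deriv v f (z + s *\<^sub>R v)) (at s)"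
    by simp_all
qed

lemma has_derivative_dir_deriv_0:
  assumes "real_polynomial_function f"
  shows "((\<lambda>s. f (z + s *\<^sub>R v)) has_real_derivative dir_deriv v f z) (at 0)"
  using has_derivative_dir_deriv[OF assms, of z v 0] by simp

lemma dir_deriv_const: "dir_deriv v (\<lambda>z. c) = (\<lambda>z. 0)"
  by (rule dir_deriv_eqI) simp

lemma dir_deriv_linear:
  assumes "bounded_linear f" shows "dir_deriv v f = (\<lambda>z. f v)"
proof (rule dir_deriv_eqI)
  interpret bounded_linear f by fact
  show "((\<lambda>s. f (z + s *\<^sub>R v)) has_real_derivative f v) (at 0)" for z
    unfolding add scaleR by (auto intro!: derivative_eq_intros)
qed

lemma dir_deriv_add:
  assumes "real_polynomial_function f" "real_polynomial_function g"
  shows "dir_deriv v (\<lambda>z. f z + g z) = (\<lambda>z. dir_deriv v f z + dir_deriv v g z)"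
  by (rule dir_deriv_eqI) (intro DERIV_add has_derivative_dir_deriv_0 assms)

lemma dir_deriv_mult:
  assumes "real_polynomial_function f" "real_polynomial_function g"
  shows "dir_deriv v (\<lambda>z. f z * g z) = (\<lambda>z. dir_deriv v f z * g z + f z * dir_deriv v g z)"
proof (rule dir_deriv_eqI)
  show "((\<lambda>s. f (z + s *\<^sub>R v) * g (z + s *\<^sub>R v)) has_real_derivative
          dir_deriv v f z * g z + f z * dir_deriv v g z) (at 0)" for z
    using DERIV_mult[OF has_derivative_dir_deriv_0[OF assms(1), of z v]
        has_derivative_dir_deriv_0[OF assms(2), of z v]]
    by (simp add: ac_simps)
qed

lemma dir_deriv_cmult:
  assumes "real_polynomial_function f"
  shows "dir_deriv v (\<lambda>z. c * f z) = (\<lambda>z. c * dir_deriv v f z)"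
  using dir_deriv_mult[OF real_polynomial_function_const[of c] assms]
  by (simp add: dir_deriv_const)

text \<open>If \<open>c\<close> were positive, \<open>f'\<close> would vanish at \<open>a\<close>
  and be positive just to the right of it. By the mean value theorem \<open>f\<close> would then
  exceed \<open>f a\<close> at a nearby point.\<close>

lemma local_max_second_derivative_nonpos:
  fixes f :: "real \<Rightarrow> real"
  assumes f: "\<And>s. (f has_real_derivative f' s) (at s)"
    and f': "(f' has_real_derivative c) (at a)"
    and "0 < d" and max: "\<And>s. \<bar>a - s\<bar> < d \<Longrightarrow> f s \<le> f a"
  shows "c \<le> 0"
proof (rule ccontr)
  assume "\<not> c \<le> 0"
  have "f' a = 0"
    using DERIV_local_max[OF f \<open>0 < d\<close>] max by blast
  moreover obtain e where "0 < e" and e: "\<And>h. 0 < h \<Longrightarrow> h < e \<Longrightarrow> f' a < f' (a + h)"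
    using DERIV_pos_inc_right[OF f'] \<open>\<not> c \<le> 0\<close> by auto
  define h where "h = min d e / 2"
  have h: "0 < h" "h < d" "h < e"
    using \<open>0 < d\<close> \<open>0 < e\<close> by (auto simp: h_def)
  obtain y where y: "a < y" "y < a + h" "f (a + h) - f a = (a + h - a) * f' y"
    using MVT2[of a "a + h" f f'] f h by auto
  moreover have "f' a < f' y"
    using e[of "y - a"] y h by simp
  ultimately have "0 < h * f' y"
    using h(1) by (intro mult_pos_pos) simp_all
  then have "f a < f (a + h)"
    using y(3) by simp
  then show False
    using max[of "a + h"] h by simp
qed

text \<open>Restrict \<open>q\<close> to the line through \<open>a\<close> and \<open>z\<close>. The
  result is a polynomial in one variable that vanishes on a nonempty open set of parameters, hence
  has infinitely many roots and is zero; the parameter 1 gives the point \<open>z\<close>.\<close>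

lemma real_polynomial_function_eq_zero_of_open:
  fixes q :: "'a::real_normed_vector \<Rightarrow> real"
  assumes q: "real_polynomial_function q" and "open S" "a \<in> S" and zero: "\<And>z. z \<in> S \<Longrightarrow> q z = 0"
  shows "q z = 0"
proof -
  define l where "l s = a + s *\<^sub>R (z - a)" for s
  have "real_polynomial_function (q \<circ> l)"
    using q
  proof (rule real_polynomial_function_compose[rotated])
    show "polynomial_function l"
      unfolding l_def
      by (intro polynomial_function_add polynomial_function_const polynomial_function_bounded_linear
          bounded_linear_scaleR_left)
  qed
  then obtain c n where c: "q \<circ> l = (\<lambda>s. \<Sum>i\<le>n. c i * s ^ i)"
    by (auto simp: real_polynomial_function_iff_sum)
  have "continuous_on UNIV l"
    unfolding l_def by (intro continuous_intros)
  then have "open (l -` S)"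
    using \<open>open S\<close> by (simp add: open_vimage)
  moreover have "0 \<in> l -` S"
    using \<open>a \<in> S\<close> by (simp add: l_def)
  ultimately have "infinite (l -` S)"
    by (metis empty_iff finite_imp_not_open)
  moreover have "l -` S \<subseteq> {s. (\<Sum>i\<le>n. c i * s ^ i) = 0}"
    using zero by (auto simp: c[unfolded o_def fun_eq_iff, rule_format, symmetric])
  ultimately have "infinite {s. (\<Sum>i\<le>n. c i * s ^ i) = 0}"
    by (metis finite_subset)
  then have "\<forall>i\<le>n. c i = 0"
    by (metis polyfun_finite_roots)
  then have "(q \<circ> l) 1 = 0"
    by (simp add: c)
  then show ?thesis
    by (simp add: l_def)
qed

section \<open>The heat operator and the maximum principle\<close>

lemma partial_x_eq: "partial_x j f = dir_deriv (axis j 1, 0) f"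
  by (auto simp: partial_x_def dir_deriv_def fun_eq_iff)

lemma partial_t_eq:
  assumes "real_polynomial_function f"
  shows "partial_t f = dir_deriv (0, 1) f"
proof
  fix z :: "(real ^ 'a) \<times> real"
  obtain x t where z: "z = (x, t)" by force
  show "partial_t f z = dir_deriv (0, 1) f z"
    \<comment> \<open>The line starts at \<open>(x, 0)\<close>, so its parameter is the time itself
      and the derivative is taken at \<open>t\<close>, as in \<open>partial_t\<close>.\<close>
    using DERIV_imp_deriv[OF has_derivative_dir_deriv[OF assms, of "(x, 0)" "(0, 1)" t]]
    by (simp add: partial_t_def z)
qed

lemma heat_op_eq:
  assumes "real_polynomial_function f"
  shows "heat_op f = (\<lambda>z. (\<Sum>j\<in>UNIV. dir_deriv (axis j 1, 0) (dir_deriv (axis j 1, 0) f) z)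
                            - dir_deriv (0, 1) f z)"
  by (simp add: heat_op_def laplacian_x_def partial_x_eq partial_t_eq[OF assms])

lemma heat_op_add:
  assumes "real_polynomial_function f" "real_polynomial_function g"
  shows "heat_op (\<lambda>z. f z + g z) = (\<lambda>z. heat_op f z + heat_op g z)"
  using assms
  by (simp add: heat_op_eq real_polynomial_function_add dir_deriv_add
      real_polynomial_function_dir_deriv sum.distrib fun_eq_iff)

lemma heat_op_cmult:
  assumes "real_polynomial_function f"
  shows "heat_op (\<lambda>z. c * f z) = (\<lambda>z. c * heat_op f z)"
  using assms
  by (simp add: heat_op_eq real_polynomial_function_mult real_polynomial_function_const
      dir_deriv_cmult real_polynomial_function_dir_deriv sum_distrib_left fun_eq_iff
      right_diff_distrib)

lemma real_polynomial_function_snd: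
  "real_polynomial_function (snd :: 'a::real_normed_vector \<times> real \<Rightarrow> real)"
  by (intro real_polynomial_function_linear bounded_linear_snd)

lemma heat_op_snd: "heat_op snd = (\<lambda>z. - 1)"
  by (simp add: heat_op_eq real_polynomial_function_snd dir_deriv_linear bounded_linear_snd
      dir_deriv_const)

text \<open>In the spatial directions one can move both ways, so the second derivatives are
  nonpositive. In time only the past is compared, which still makes the time derivative nonnegative;
  this is why the lemma also covers maxima on the top slice of a truncated region.\<close>

lemma heat_op_nonpos_at_max:
  fixes v :: "(real ^ 'n::finite) \<times> real \<Rightarrow> real"
  assumes v: "real_polynomial_function v"
    and "(norm x)\<^sup>2 < t"
    and max: "\<And>y s. (norm y)\<^sup>2 \<le> s \<Longrightarrow> s \<le> t \<Longrightarrow> v (y, s) \<le> v (x, t)"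
  shows "heat_op v (x, t) \<le> 0"
proof -
  have "dir_deriv (axis j 1, 0) (dir_deriv (axis j 1, 0) v) (x, t) \<le> 0" for j
  proof -
    let ?e = "(axis j 1, 0) :: (real ^ 'n) \<times> real"
    have "open ((\<lambda>s. (norm (x + s *\<^sub>R axis j 1))\<^sup>2) -` {..<t})"
      by (intro open_vimage open_lessThan continuous_intros)
    moreover have "0 \<in> (\<lambda>s. (norm (x + s *\<^sub>R axis j 1))\<^sup>2) -` {..<t}"
      using assms(2) by simp
    ultimately obtain d where "0 < d"
      and d: "ball 0 d \<subseteq> (\<lambda>s. (norm (x + s *\<^sub>R axis j 1))\<^sup>2) -` {..<t}"
      using open_contains_ball by blast
    show ?thesis
    proof (rule local_max_second_derivative_nonpos)
      show "((\<lambda>s. v ((x, t) + s *\<^sub>R ?e)) has_real_derivative dir_deriv ?e v ((x, t) + s *\<^sub>R ?e)) (at s)" for s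
        by (rule has_derivative_dir_deriv[OF v])
      show "((\<lambda>s. dir_deriv ?e v ((x, t) + s *\<^sub>R ?e)) has_real_derivative
              dir_deriv ?e (dir_deriv ?e v) (x, t)) (at 0)"
        by (intro has_derivative_dir_deriv_0 real_polynomial_function_dir_deriv v)
      show "v ((x, t) + s *\<^sub>R ?e) \<le> v ((x, t) + 0 *\<^sub>R ?e)" if "\<bar>0 - s\<bar> < d" for s
      proof -
        have "(norm (x + s *\<^sub>R axis j 1))\<^sup>2 < t"
          using d that by (auto simp: subset_iff)
        then show ?thesis
          using max[of "x + s *\<^sub>R axis j 1" t] by simp
      qed
    qed fact
  qed
  moreover have "0 \<le> dir_deriv (0, 1) v (x, t)"
  proof (rule ccontr)
    assume "\<not> 0 \<le> dir_deriv (0, 1) v (x, t)"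
    then obtain d where "0 < d"
      and d: "\<And>h. 0 < h \<Longrightarrow> h < d \<Longrightarrow> v (x, t) < v (x, t - h)"
      using DERIV_neg_dec_left[OF has_derivative_dir_deriv_0[OF v, of "(x, t)" "(0, 1)"]] by auto
    \<comment> \<open>The second bound keeps the earlier point \<open>(x, t - h)\<close> above the
      paraboloid, where the maximality assumption applies.\<close>
    define h where "h = min d (t - (norm x)\<^sup>2) / 2"
    have "0 < h" "h < d" "h < t - (norm x)\<^sup>2"
      using \<open>0 < d\<close> assms(2) by (auto simp: h_def)
    then show False
      using d[of h] max[of x "t - h"] by simp
  qed
  ultimately show ?thesis
    using sum_nonpos[of UNIV "\<lambda>j. dir_deriv (axis j 1, 0) (dir_deriv (axis j 1, 0) v) (x, t)"]
    by (simp add: heat_op_eq[OF v])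
qed

text \<open>The region lies in a cylinder of radius \<open>sqrt t\<close> over the time interval
  from 0 to \<open>t\<close>. Its compactness provides the maximum point in the maximum
  principle.\<close>

lemma compact_paraboloid_segment:
  "compact {z :: (real ^ 'n::finite) \<times> real. (norm (fst z))\<^sup>2 \<le> snd z \<and> snd z \<le> t}"
proof -
  have "bounded {z :: (real ^ 'n) \<times> real. (norm (fst z))\<^sup>2 \<le> snd z \<and> snd z \<le> t}"
  proof (rule bounded_subset)
    show "bounded (cball (0 :: real ^ 'n) (sqrt t) \<times> {0..t})"
      by (intro bounded_Times bounded_cball bounded_closed_interval)
    show "{z :: (real ^ 'n) \<times> real. (norm (fst z))\<^sup>2 \<le> snd z \<and> snd z \<le> t}
        \<subseteq> cball 0 (sqrt t) \<times> {0..t}"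
    proof
      fix z :: "(real ^ 'n) \<times> real"
      assume "z \<in> {z. (norm (fst z))\<^sup>2 \<le> snd z \<and> snd z \<le> t}"
      then have z: "(norm (fst z))\<^sup>2 \<le> snd z" "snd z \<le> t" by auto
      then have "norm (fst z) \<le> sqrt t"
        by (intro real_le_rsqrt) simp
      moreover have "0 \<le> snd z"
        using z(1) zero_le_power2[of "norm (fst z)"] by linarith
      ultimately show "z \<in> cball 0 (sqrt t) \<times> {0..t}"
        using z by (cases z) simp
    qed
  qed
  moreover have "closed {z :: (real ^ 'n) \<times> real. (norm (fst z))\<^sup>2 \<le> snd z \<and> snd z \<le> t}"
    by (intro closed_Collect_conj closed_Collect_le continuous_intros)
  ultimately show ?thesis
    by (simp add: compact_eq_bounded_closed)
qed

text \<open>Subtracting \<open>e\<close> times the time makes the equation strict: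
  \<open>heat_op v\<close> equals \<open>e > 0\<close>, which is impossible at a maximum off the
  paraboloid. A maximum on the paraboloid would be nonpositive, although \<open>v\<close> is
  positive at \<open>(x, t)\<close>.\<close>

lemma heat_maximum_principle:
  fixes u :: "(real ^ 'n::finite) \<times> real \<Rightarrow> real"
  assumes u: "real_polynomial_function u"
    and heat: "\<And>z. heat_op u z = 0"
    and bdry: "\<And>x. u (x, (norm x)\<^sup>2) \<le> 0"
    and "(norm x)\<^sup>2 \<le> t"
  shows "u (x, t) \<le> 0"
proof (rule ccontr)
  assume pos: "\<not> u (x, t) \<le> 0"
  have "0 \<le> t" using assms(4) zero_le_power2[of "norm x"] by linarith
  \<comment> \<open>This choice leaves \<open>v (x, t) = u (x, t) / (t + 1) > 0\<close>; the added 1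
    avoids division by zero when \<open>t = 0\<close>.\<close>
  define e where "e = u (x, t) / (t + 1)"
  have "0 < e" and e: "e * t < u (x, t)"
    using pos \<open>0 \<le> t\<close> by (simp_all add: e_def field_simps)
  define v where "v z = u z + (- e) * snd z" for z
  have pe: "real_polynomial_function (\<lambda>z :: (real ^ 'n) \<times> real. (- e) * snd z)"
    by (intro real_polynomial_function.intros bounded_linear_snd)
  have v: "real_polynomial_function v"
    unfolding v_def by (intro real_polynomial_function_add u pe)
  have heat_v: "heat_op v z = e" for z
    unfolding v_def heat_op_add[OF u pe] heat_op_cmult[OF real_polynomial_function_snd]
    by (simp add: heat heat_op_snd)
  let ?K = "{z :: (real ^ 'n) \<times> real. (norm (fst z))\<^sup>2 \<le> snd z \<and> snd z \<le> t}"
  have "(x, t) \<in> ?K" using assms(4) by simp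
  then obtain z0 where z0: "z0 \<in> ?K" "\<And>z. z \<in> ?K \<Longrightarrow> v z \<le> v z0"
    using continuous_attains_sup[OF compact_paraboloid_segment[of t] _
        continuous_on_polymonial_function[OF v[unfolded real_polynomial_function_eq]]]
    by blast
  obtain x0 t0 where z0_eq: "z0 = (x0, t0)" by force
  show False
  proof (cases "(norm x0)\<^sup>2 = t0")
    case True
    have "0 \<le> e * t0"
      using \<open>0 < e\<close> True by (intro mult_nonneg_nonneg) auto
    then have "v z0 \<le> 0"
      using bdry[of x0] True by (simp add: v_def z0_eq)
    moreover have "v (x, t) \<le> v z0"
      using z0(2) assms(4) by simp
    ultimately show False
      using e by (simp add: v_def)
  next
    case False
    have "heat_op v (x0, t0) \<le> 0"
    proof (rule heat_op_nonpos_at_max[OF v])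
      show "(norm x0)\<^sup>2 < t0" using False z0(1) by (simp add: z0_eq)
      show "v (y, s) \<le> v (x0, t0)" if "(norm y)\<^sup>2 \<le> s" "s \<le> t0" for y s
        using z0(2)[of "(y, s)"] that z0(1) by (simp add: z0_eq)
    qed
    then show False using heat_v \<open>0 < e\<close> by simp
  qed
qed

section \<open>The polynomial w and injectivity of the map sending q to H(wq)\<close>

lemma bounded_linear_fst_nth: "bounded_linear (\<lambda>z :: (real ^ 'n::finite) \<times> real. fst z $ j)"
  by (rule bounded_linear_compose[OF bounded_linear_vec_nth bounded_linear_fst])

lemma real_polynomial_function_w_poly:
  "real_polynomial_function (w_poly :: (real ^ 'n::finite) \<times> real \<Rightarrow> real)"
proof -
  have "w_poly = (\<lambda>z :: (real ^ 'n) \<times> real. snd z + (- 1) * (\<Sum>j\<in>UNIV. (fst z $ j) ^ 2))"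
    by (auto simp: w_poly_def fun_eq_iff power2_norm_eq_inner inner_vec_def simp flip: power2_eq_square)
  moreover have "real_polynomial_function \<dots>"
    by (intro real_polynomial_function_add real_polynomial_function_snd real_polynomial_function_mult
        real_polynomial_function_const real_polynomial_function_sum real_polynomial_function_power
        real_polynomial_function_linear bounded_linear_fst_nth) simp
  ultimately show ?thesis by simp
qed

lemma heat_op_w_poly_mult_injective:
  fixes q :: "(real ^ 'n::finite) \<times> real \<Rightarrow> real"
  assumes q: "real_polynomial_function q"
    and heat: "\<And>z. heat_op (\<lambda>z. w_poly z * q z) z = 0"
  shows "q z = 0"
proof (rule real_polynomial_function_eq_zero_of_open[OF q])
  let ?S = "{z :: (real ^ 'n) \<times> real. (norm (fst z))\<^sup>2 < snd z}"
  show "open ?S"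
    by (intro open_Collect_less continuous_intros)
  show "(0, 1) \<in> ?S" by simp
  have wq: "real_polynomial_function (\<lambda>z. w_poly z * q z)"
    by (intro real_polynomial_function_mult q real_polynomial_function_w_poly)
  have mwq: "real_polynomial_function (\<lambda>z. (- 1) * (w_poly z * q z))"
    by (intro real_polynomial_function_mult[OF real_polynomial_function_const wq])
  show "q z = 0" if "z \<in> ?S" for z
  proof -
    obtain x t where z: "z = (x, t)" by force
    with that have xt: "(norm x)\<^sup>2 < t" by simp
    have "w_poly (x, t) * q (x, t) \<le> 0"
      by (rule heat_maximum_principle[OF wq heat _ less_imp_le[OF xt]]) (simp add: w_poly_def)
    \<comment> \<open>The maximum principle only bounds from above, so it is applied to the negative
      of \<open>w q\<close> as well. Then \<open>w q = 0\<close> at \<open>(x, t)\<close>, and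
      \<open>w\<close> is positive there.\<close>
    moreover have "heat_op (\<lambda>z. (- 1) * (w_poly z * q z)) z = 0" for z
      unfolding heat_op_cmult[OF wq] by (simp add: heat)
    then have "(- 1) * (w_poly (x, t) * q (x, t)) \<le> 0"
      by (rule heat_maximum_principle[OF mwq _ _ less_imp_le[OF xt]]) (simp add: w_poly_def)
    ultimately show "q z = 0"
      using xt by (simp add: z w_poly_def)
  qed
qed

section \<open>Polynomials of bounded parabolic degree\<close>

text \<open>The index is an upper bound, not an exact degree: constants get every bound and sums
  keep theirs, so cancellation needs no care and each bound defines a linear subspace.\<close>

inductive parabolic_deg_le :: "nat \<Rightarrow> ((real ^ 'n::finite) \<times> real \<Rightarrow> real) \<Rightarrow> bool" where
  const: "parabolic_deg_le m (\<lambda>z. c)"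
| add: "parabolic_deg_le m f \<Longrightarrow> parabolic_deg_le m g \<Longrightarrow> parabolic_deg_le m (\<lambda>z. f z + g z)"
| mult_x: "parabolic_deg_le m f \<Longrightarrow> parabolic_deg_le (Suc m) (\<lambda>z. fst z $ j * f z)"
| mult_t: "parabolic_deg_le m f \<Longrightarrow> parabolic_deg_le (Suc (Suc m)) (\<lambda>z. snd z * f z)"

section \<open>Closure properties of the degree bound\<close>

lemma parabolic_deg_le_imp_polynomial:
  "parabolic_deg_le m f \<Longrightarrow> real_polynomial_function f"
  by (induction rule: parabolic_deg_le.induct)
    (simp_all add: real_polynomial_function_const real_polynomial_function_add
      real_polynomial_function_mult real_polynomial_function_snd
      real_polynomial_function_linear[OF bounded_linear_fst_nth])

lemma parabolic_deg_le_mono: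
  "parabolic_deg_le m f \<Longrightarrow> m \<le> n \<Longrightarrow> parabolic_deg_le n f"
proof (induction arbitrary: n rule: parabolic_deg_le.induct)
  case (mult_x m f j)
  then show ?case by (cases n) (auto intro: parabolic_deg_le.intros)
next
  case (mult_t m f)
  then obtain k where "n = Suc (Suc k)" by (metis Suc_le_D Suc_le_mono)
  with mult_t show ?case by (auto intro: parabolic_deg_le.intros)
qed (auto intro: parabolic_deg_le.intros)

lemma parabolic_deg_le_cmult:
  "parabolic_deg_le m f \<Longrightarrow> parabolic_deg_le m (\<lambda>z. c * f z)"
proof (induction rule: parabolic_deg_le.induct)
  case (add m f g)
  then show ?case by (simp add: distrib_left parabolic_deg_le.add)
next
  case (mult_x m f j)
  then show ?case using parabolic_deg_le.mult_x[of m "\<lambda>z. c * f z" j] by (simp add: ac_simps)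
next
  case (mult_t m f)
  then show ?case using parabolic_deg_le.mult_t[of m "\<lambda>z. c * f z"] by (simp add: ac_simps)
qed (rule parabolic_deg_le.const)

lemma parabolic_deg_le_sum:
  "finite A \<Longrightarrow> (\<And>i. i \<in> A \<Longrightarrow> parabolic_deg_le m (f i)) \<Longrightarrow> parabolic_deg_le m (\<lambda>z. \<Sum>i\<in>A. f i z)"
  by (induction rule: finite_induct) (auto intro: parabolic_deg_le.intros)

lemma parabolic_deg_le_diff:
  "parabolic_deg_le m f \<Longrightarrow> parabolic_deg_le m g \<Longrightarrow> parabolic_deg_le m (\<lambda>z. f z - g z)"
  using parabolic_deg_le.add[OF _ parabolic_deg_le_cmult[of m g "- 1"]] by simp

lemma parabolic_deg_le_mult:
  assumes "parabolic_deg_le m f" "parabolic_deg_le n g"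
  shows "parabolic_deg_le (m + n) (\<lambda>z. f z * g z)"
  using assms(1)
proof (induction rule: parabolic_deg_le.induct)
  case (const m c)
  then show ?case
    by (intro parabolic_deg_le_cmult parabolic_deg_le_mono[OF assms(2)]) simp
qed (simp_all add: distrib_right mult.assoc parabolic_deg_le.intros)

lemma parabolic_deg_le_fst_nth: "parabolic_deg_le 1 (\<lambda>z. fst z $ j)"
  using mult_x[OF const[of 0 1]] by simp

lemma parabolic_deg_le_snd: "parabolic_deg_le 2 snd"
  using mult_t[OF const[of 0 1]] by (simp add: numeral_2_eq_2)

text \<open>The generators of \<open>real_polynomial_function\<close> are arbitrary bounded linear
  functionals, while \<open>parabolic_deg_le\<close> is built from coordinates; this expansion in
  the standard basis connects the two.\<close>

lemma linear_eq_coordinates: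
  fixes f :: "(real ^ 'n::finite) \<times> real \<Rightarrow> real"
  assumes "bounded_linear f"
  shows "f z = (\<Sum>j\<in>UNIV. f (axis j 1, 0) * fst z $ j) + f (0, 1) * snd z"
proof -
  interpret bounded_linear f by fact
  have "z = (\<Sum>j\<in>UNIV. (fst z $ j) *\<^sub>R (axis j 1, 0)) + snd z *\<^sub>R (0, 1)"
    using basis_expansion[of "fst z"]
    by (simp add: prod_eq_iff fst_sum snd_sum scalar_mult_eq_scaleR)
  then have "f z = f ((\<Sum>j\<in>UNIV. (fst z $ j) *\<^sub>R (axis j 1, 0)) + snd z *\<^sub>R (0, 1))"
    by simp
  then show ?thesis
    by (simp add: add sum scaleR mult.commute del: scaleR_Pair)
qed

lemma polynomial_imp_parabolic_deg_le:
  assumes "real_polynomial_function f"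
  shows "\<exists>m. parabolic_deg_le m f"
  using assms
proof induction
  case (linear f)
  have "f = (\<lambda>z. (\<Sum>j\<in>UNIV. f (axis j 1, 0) * fst z $ j) + f (0, 1) * snd z)"
    using linear_eq_coordinates[OF linear] by (rule ext)
  \<comment> \<open>A linear functional may involve \<open>t\<close>, which has weight 2; the bounds
    of the spatial coordinates are weakened from 1 to 2.\<close>
  moreover have "parabolic_deg_le 2
      (\<lambda>z. (\<Sum>j\<in>UNIV. f (axis j 1, 0) * fst z $ j) + f (0, 1) * snd z)"
    by (intro parabolic_deg_le.add parabolic_deg_le_sum parabolic_deg_le_cmult
        parabolic_deg_le_snd parabolic_deg_le_mono[OF parabolic_deg_le_fst_nth]) auto
  ultimately show ?case by metis
next
  case (const c)
  show ?case by (blast intro: parabolic_deg_le.const)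
next
  case (add f g)
  then obtain m n where "parabolic_deg_le m f" "parabolic_deg_le n g" by blast
  then have "parabolic_deg_le (max m n) (\<lambda>z. f z + g z)"
    by (intro parabolic_deg_le.add) (auto elim: parabolic_deg_le_mono)
  then show ?case by blast
next
  case (mult f g)
  then show ?case by (blast intro: parabolic_deg_le_mult)
qed

text \<open>The induction needs the first disjunct: a derivative known only to have degree at most the
  truncated \<open>m - 1\<close> would give \<open>f\<close> of degree 0 a degree 1 bound for the derivative of \<open>x\<^sub>j f\<close>.\<close>

lemma parabolic_deg_le_dir_deriv_x_aux:
  assumes "parabolic_deg_le m f"
  shows "dir_deriv (axis i 1, 0) f = (\<lambda>z. 0) \<or>
         (\<exists>n. m = Suc n \<and> parabolic_deg_le n (dir_deriv (axis i 1, 0) f))"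
  using assms
proof (induction rule: parabolic_deg_le.induct)
  case (const m c)
  show ?case by (simp add: dir_deriv_const)
next
  case (add m f g)
  then show ?case
    by (auto simp: dir_deriv_add parabolic_deg_le_imp_polynomial intro: parabolic_deg_le.add)
next
  case (mult_x m f j)
  have "dir_deriv (axis i 1, 0) (\<lambda>z. fst z $ j * f z) =
      (\<lambda>z. axis i 1 $ j * f z + fst z $ j * dir_deriv (axis i 1, 0) f z)"
    by (simp add: dir_deriv_mult dir_deriv_linear bounded_linear_fst_nth mult_x.hyps
        real_polynomial_function_linear parabolic_deg_le_imp_polynomial[OF mult_x.hyps])
  moreover have "parabolic_deg_le m (\<lambda>z. fst z $ j * dir_deriv (axis i 1, 0) f z)"
    using mult_x.IH by (auto intro: parabolic_deg_le.intros)
  ultimately show ?case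
    by (auto intro!: parabolic_deg_le.add parabolic_deg_le_cmult mult_x.hyps)
next
  case (mult_t m f)
  have "dir_deriv (axis i 1, 0) (\<lambda>z. snd z * f z) =
      (\<lambda>z. snd z * dir_deriv (axis i 1, 0) f z)"
    by (simp add: dir_deriv_mult dir_deriv_linear bounded_linear_snd
        real_polynomial_function_linear parabolic_deg_le_imp_polynomial[OF mult_t.hyps])
  with mult_t.IH show ?case
    by (auto intro: parabolic_deg_le.intros)
qed

text \<open>As for the spatial derivatives, the disjunct with zero derivative covers the bounds 0
  and 1, which cannot drop by two.\<close>

lemma parabolic_deg_le_dir_deriv_t_aux:
  assumes "parabolic_deg_le m f"
  shows "dir_deriv (0, 1) f = (\<lambda>z. 0) \<or>
         (\<exists>n. m = Suc (Suc n) \<and> parabolic_deg_le n (dir_deriv (0, 1) f))"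
  using assms
proof (induction rule: parabolic_deg_le.induct)
  case (const m c)
  show ?case by (simp add: dir_deriv_const)
next
  case (add m f g)
  then show ?case
    by (auto simp: dir_deriv_add parabolic_deg_le_imp_polynomial intro: parabolic_deg_le.add)
next
  case (mult_x m f j)
  have "dir_deriv (0, 1) (\<lambda>z. fst z $ j * f z) = (\<lambda>z. fst z $ j * dir_deriv (0, 1) f z)"
    by (simp add: dir_deriv_mult dir_deriv_linear bounded_linear_fst_nth
        real_polynomial_function_linear parabolic_deg_le_imp_polynomial[OF mult_x.hyps])
  with mult_x.IH show ?case
    by (auto intro: parabolic_deg_le.intros)
next
  case (mult_t m f)
  have "dir_deriv (0, 1) (\<lambda>z. snd z * f z) = (\<lambda>z. f z + snd z * dir_deriv (0, 1) f z)"
    by (simp add: dir_deriv_mult dir_deriv_linear bounded_linear_snd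
        real_polynomial_function_linear parabolic_deg_le_imp_polynomial[OF mult_t.hyps])
  moreover have "parabolic_deg_le m (\<lambda>z. snd z * dir_deriv (0, 1) f z)"
    using mult_t.IH by (auto intro: parabolic_deg_le.intros)
  ultimately show ?case
    by (auto intro!: parabolic_deg_le.add mult_t.hyps)
qed

lemma parabolic_deg_le_dir_deriv_x:
  "parabolic_deg_le (Suc m) f \<Longrightarrow> parabolic_deg_le m (dir_deriv (axis i 1, 0) f)"
  using parabolic_deg_le_dir_deriv_x_aux[of "Suc m" f i] by (auto intro: parabolic_deg_le.const)

lemma parabolic_deg_le_dir_deriv_t:
  "parabolic_deg_le (Suc (Suc m)) f \<Longrightarrow> parabolic_deg_le m (dir_deriv (0, 1) f)"
  using parabolic_deg_le_dir_deriv_t_aux[of "Suc (Suc m)" f] by (auto intro: parabolic_deg_le.const)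

lemma parabolic_deg_le_heat_op:
  assumes "parabolic_deg_le (Suc (Suc m)) f"
  shows "parabolic_deg_le m (heat_op f)"
  unfolding heat_op_eq[OF parabolic_deg_le_imp_polynomial[OF assms]]
  by (intro parabolic_deg_le_diff parabolic_deg_le_sum parabolic_deg_le_dir_deriv_x
      parabolic_deg_le_dir_deriv_t assms) simp

lemma parabolic_deg_le_w_poly:
  "parabolic_deg_le 2 (w_poly :: (real ^ 'n::finite) \<times> real \<Rightarrow> real)"
proof -
  have "w_poly = (\<lambda>z :: (real ^ 'n) \<times> real. snd z - (\<Sum>j\<in>UNIV. fst z $ j * fst z $ j))"
    by (auto simp: w_poly_def fun_eq_iff power2_norm_eq_inner inner_vec_def)
  moreover have "parabolic_deg_le 2 (\<lambda>z :: (real ^ 'n) \<times> real. fst z $ j * fst z $ j)" for j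
    using parabolic_deg_le_mult[OF parabolic_deg_le_fst_nth[of j] parabolic_deg_le_fst_nth[of j]]
    by (simp add: numeral_2_eq_2)
  then have "parabolic_deg_le 2 (\<lambda>z :: (real ^ 'n) \<times> real. snd z - (\<Sum>j\<in>UNIV. fst z $ j * fst z $ j))"
    by (intro parabolic_deg_le_diff parabolic_deg_le_sum parabolic_deg_le_snd) simp_all
  ultimately show ?thesis
    by simp
qed

section \<open>Finite dimension and surjectivity\<close>

interpretation fun_vs: vector_space "\<lambda>(c::real) f z. c * f z :: real"
  by unfold_locales (auto simp: fun_eq_iff algebra_simps)

text \<open>\<open>T\<close> is assumed linear on \<open>V\<close> only, since the heat operator is
  shown to be linear on polynomials only. Its values on a basis \<open>C\<close> of \<open>V\<close>
  extend to a globally linear \<open>g\<close> that agrees with \<open>T\<close> on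
  \<open>V\<close>. By injectivity \<open>g\<close> maps \<open>C\<close> to an independent subset
  of \<open>V\<close> of the same size, which must span \<open>V\<close>.\<close>

lemma (in vector_space) endo_on_fin_dim_subspace_surj:
  assumes V: "subspace V" and "V \<subseteq> span B" "finite B"
    and T: "\<And>x. x \<in> V \<Longrightarrow> T x \<in> V"
    and add: "\<And>x y. x \<in> V \<Longrightarrow> y \<in> V \<Longrightarrow> T (x + y) = T x + T y"
    and scale: "\<And>c x. x \<in> V \<Longrightarrow> T (scale c x) = scale c (T x)"
    and inj: "\<And>x. x \<in> V \<Longrightarrow> T x = 0 \<Longrightarrow> x = 0"
  shows "T ` V = V"
proof -
  interpret vector_space_pair scale scale ..
  obtain C where C: "C \<subseteq> V" "independent C" "V \<subseteq> span C"
    using maximal_independent_subset[of V] by blast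
  have "span C = V"
    using C V by (simp add: span_subspace)
  have "finite C"
    using independent_span_bound[OF \<open>finite B\<close> C(2)] C(1) assms(2) by blast
  obtain g where g: "Vector_Spaces.linear scale scale g" "\<And>x. x \<in> C \<Longrightarrow> g x = T x"
    using linear_independent_extend[OF C(2), of T] by blast
  interpret g: Vector_Spaces.linear scale scale g by fact
  have "T 0 = 0"
    using scale[of 0 0] subspace_0[OF V] by simp
  have g_eq: "g x = T x" if "x \<in> V" for x
  proof -
    have "x \<in> span C" using that C by blast
    \<comment> \<open>Membership in \<open>V\<close> is carried through the induction because
      additivity and homogeneity of \<open>T\<close> are available only there.\<close>
    then have "x \<in> V \<and> g x = T x"
    proof (induction rule: span_induct_alt)
      case base
      then show ?case using \<open>T 0 = 0\<close> subspace_0[OF V] g.zero by simp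
    next
      case (step c x y)
      then have "x \<in> V" using C by blast
      with step show ?case
        using V g(2) by (simp add: g.add g.scale add scale subspace_add subspace_scale)
    qed
    then show ?thesis by simp
  qed
  have inj_g: "inj_on g (span C)"
    using inj by (simp add: g.inj_on_iff_eq_0 \<open>span C = V\<close> V g_eq)
  have ind: "independent (g ` C)"
    by (rule linear_independent_injective_image[OF g(1) C(2) inj_g])
  have card: "card (g ` C) = card C"
    using inj_g by (meson card_image inj_on_subset span_superset)
  have gC: "g ` C \<subseteq> V"
    using T C(1) g(2) by auto
  have "V \<subseteq> span (g ` C)"
  proof
    fix x assume "x \<in> V"
    show "x \<in> span (g ` C)"
    proof (rule ccontr)
      \<comment> \<open>A vector outside the span would yield an independent set with one element
        more than \<open>C\<close> inside \<open>span C\<close>.\<close>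
      assume x: "x \<notin> span (g ` C)"
      then have "independent (insert x (g ` C))"
        using ind by (simp add: independent_insert span_base)
      moreover have "insert x (g ` C) \<subseteq> span C"
        using gC \<open>x \<in> V\<close> \<open>span C = V\<close> by simp
      ultimately have "card (insert x (g ` C)) \<le> card C"
        using independent_span_bound[OF \<open>finite C\<close>] by blast
      moreover have "x \<notin> g ` C"
        using x span_base by blast
      ultimately show False
        using \<open>finite C\<close> card by simp
    qed
  qed
  then have "V \<subseteq> g ` V"
    using \<open>span C = V\<close> linear_span_image[OF g(1), of C] by simp
  then show ?thesis
    using T g_eq by (auto simp: image_iff subset_iff)
qed

text \<open>The recursion mirrors the rules of \<open>parabolic_deg_le\<close>: a factor
  \<open>t\<close> uses up two units of the bound, hence the two base cases. The same monomial may
  arise from several products, which is harmless because only finiteness and spanning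
  matter.\<close>

fun parabolic_monomials :: "nat \<Rightarrow> ((real ^ 'n::finite) \<times> real \<Rightarrow> real) set" where
  "parabolic_monomials 0 = {\<lambda>z. 1}"
| "parabolic_monomials (Suc 0) = insert (\<lambda>z. 1) (range (\<lambda>j z. fst z $ j))"
| "parabolic_monomials (Suc (Suc m)) = insert (\<lambda>z. 1)
     ((\<Union>j. (\<lambda>f z. fst z $ j * f z) ` parabolic_monomials (Suc m)) \<union>
      (\<lambda>f z. snd z * f z) ` parabolic_monomials m)"

lemma finite_parabolic_monomials: "finite (parabolic_monomials m)"
  by (induction m rule: parabolic_monomials.induct) auto

text \<open>Multiplication by a fixed function is linear, so it carries spans to spans; this handles
  both multiplication rules of \<open>parabolic_deg_le\<close>.\<close>

lemma span_times_image:
  assumes "f \<in> fun_vs.span B"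
  shows "(\<lambda>z. h z * f z) \<in> fun_vs.span ((\<lambda>f z. h z * f z) ` B)"
  using assms
proof (induction rule: fun_vs.span_induct_alt)
  case base
  show ?case using fun_vs.span_zero by (simp add: zero_fun_def)
next
  case (step c x y)
  have "(\<lambda>z. h z * x z) \<in> fun_vs.span ((\<lambda>f z. h z * f z) ` B)"
    using step by (intro fun_vs.span_base) auto
  from fun_vs.span_add[OF fun_vs.span_scale[OF this, of c] step.IH]
  show ?case by (simp add: plus_fun_def algebra_simps)
qed

lemma parabolic_deg_le_in_span:
  "parabolic_deg_le m f \<Longrightarrow> f \<in> fun_vs.span (parabolic_monomials m)"
proof (induction rule: parabolic_deg_le.induct)
  case (const m c)
  have "(\<lambda>z. 1) \<in> fun_vs.span (parabolic_monomials m)"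
    by (induction m rule: parabolic_monomials.induct) (auto intro: fun_vs.span_base)
  from fun_vs.span_scale[OF this, of c] show ?case by simp
next
  case (add m f g)
  from fun_vs.span_add[OF add.IH] show ?case by (simp add: plus_fun_def)
next
  case (mult_x m f j)
  have "(\<lambda>f z. fst z $ j * f z) ` parabolic_monomials m \<subseteq> parabolic_monomials (Suc m)"
    by (cases m) auto
  from fun_vs.span_mono[OF this] show ?case
    using span_times_image[OF mult_x.IH, of "\<lambda>z. fst z $ j"] by blast
next
  case (mult_t m f)
  have "(\<lambda>f z. snd z * f z) ` parabolic_monomials m \<subseteq> parabolic_monomials (Suc (Suc m))"
    by auto
  from fun_vs.span_mono[OF this] show ?case
    using span_times_image[OF mult_t.IH, of snd] by blast
qed

lemma heat_op_w_poly_mult_surjective: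
  fixes g :: "(real ^ 'n::finite) \<times> real \<Rightarrow> real"
  assumes "parabolic_deg_le m g"
  shows "\<exists>q. parabolic_deg_le m q \<and> heat_op (\<lambda>z. w_poly z * q z) = g"
proof -
  let ?T = "\<lambda>q :: (real ^ 'n) \<times> real \<Rightarrow> real. heat_op (\<lambda>z. w_poly z * q z)"
  have poly: "real_polynomial_function (\<lambda>z. w_poly z * q z)" if "parabolic_deg_le m q"
    for q :: "(real ^ 'n) \<times> real \<Rightarrow> real"
    by (intro real_polynomial_function_mult real_polynomial_function_w_poly
        parabolic_deg_le_imp_polynomial[OF that])
  have "?T ` Collect (parabolic_deg_le m) = Collect (parabolic_deg_le m)"
  proof (rule fun_vs.endo_on_fin_dim_subspace_surj)
    show "fun_vs.subspace (Collect (parabolic_deg_le m))"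
      by (rule fun_vs.subspaceI)
        (auto simp: zero_fun_def plus_fun_def intro: parabolic_deg_le.intros parabolic_deg_le_cmult)
    show "Collect (parabolic_deg_le m) \<subseteq> fun_vs.span (parabolic_monomials m)"
      using parabolic_deg_le_in_span by blast
    show "finite (parabolic_monomials m)"
      by (rule finite_parabolic_monomials)
    show "?T q \<in> Collect (parabolic_deg_le m)" if "q \<in> Collect (parabolic_deg_le m)" for q
      using parabolic_deg_le_mult[OF parabolic_deg_le_w_poly, of m q] that
      by (simp add: parabolic_deg_le_heat_op)
    show "?T (q + r) = ?T q + ?T r"
      if "q \<in> Collect (parabolic_deg_le m)" "r \<in> Collect (parabolic_deg_le m)" for q r
      using heat_op_add[OF poly poly, of q r] that by (simp add: plus_fun_def distrib_left)
    show "?T (\<lambda>z. c * q z) = (\<lambda>z. c * ?T q z)" if "q \<in> Collect (parabolic_deg_le m)" for c q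
      using heat_op_cmult[OF poly, of q c] that by (simp add: mult.left_commute)
    show "q = 0" if "q \<in> Collect (parabolic_deg_le m)" "?T q = 0" for q
      using heat_op_w_poly_mult_injective[of q] that parabolic_deg_le_imp_polynomial[of m q]
      by (auto simp: fun_eq_iff)
  qed
  then have "g \<in> ?T ` Collect (parabolic_deg_le m)"
    using assms by simp
  then show ?thesis by auto
qed

section \<open>Existence and uniqueness of q\<close>

theorem theorem1p1:
  fixes p :: "(real ^ 'n::finite) \<times> real \<Rightarrow> real"
  assumes "real_polynomial_function p"
  shows "\<exists>!q. real_polynomial_function q \<and>
           heat_op (\<lambda>z. w_poly z * q z) = (\<lambda>z. - heat_op p z)"
proof (rule ex_ex1I)
  obtain m where "parabolic_deg_le m p"
    using polynomial_imp_parabolic_deg_le[OF assms] by blast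
  \<comment> \<open>The bound on \<open>p\<close> is first weakened to \<open>m + 2\<close> and then
    lowered by two, which avoids treating \<open>m < 2\<close> separately.\<close>
  then have "parabolic_deg_le m (heat_op p)"
    by (intro parabolic_deg_le_heat_op) (auto intro: parabolic_deg_le_mono)
  then have "parabolic_deg_le m (\<lambda>z. - heat_op p z)"
    using parabolic_deg_le_cmult[of m "heat_op p" "- 1"] by simp
  then show "\<exists>q. real_polynomial_function q \<and>
      heat_op (\<lambda>z. w_poly z * q z) = (\<lambda>z. - heat_op p z)"
    using heat_op_w_poly_mult_surjective parabolic_deg_le_imp_polynomial by metis
next
  fix q r :: "(real ^ 'n) \<times> real \<Rightarrow> real"
  assume q: "real_polynomial_function q \<and> heat_op (\<lambda>z. w_poly z * q z) = (\<lambda>z. - heat_op p z)"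
    and r: "real_polynomial_function r \<and> heat_op (\<lambda>z. w_poly z * r z) = (\<lambda>z. - heat_op p z)"
  have wq: "real_polynomial_function (\<lambda>z. w_poly z * q z)"
    and wr: "real_polynomial_function (\<lambda>z. w_poly z * r z)"
    using q r by (auto intro!: real_polynomial_function_mult real_polynomial_function_w_poly)
  \<comment> \<open>Injectivity is applied to the difference of two solutions, written as a sum with
    a scalar multiple to fit \<open>heat_op_add\<close> and \<open>heat_op_cmult\<close>.\<close>
  have "real_polynomial_function (\<lambda>z. q z + (- 1) * r z)"
    using q r by (intro real_polynomial_function_add real_polynomial_function_mult
        real_polynomial_function_const) simp_all
  moreover have "heat_op (\<lambda>z. w_poly z * (q z + (- 1) * r z)) z = 0" for z
  proof -
    have "real_polynomial_function (\<lambda>z. (- 1) * (w_poly z * r z))"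
      by (rule real_polynomial_function_mult[OF real_polynomial_function_const wr])
    from heat_op_add[OF wq this] show ?thesis
      using q r unfolding heat_op_cmult[OF wr] by (simp add: algebra_simps)
  qed
  ultimately have "q z + (- 1) * r z = 0" for z
    by (rule heat_op_w_poly_mult_injective)
  then show "q = r"
    by (simp add: fun_eq_iff)
qed

end
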